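(* There exist EDT0L languages of intermediate growth, and there exist ET0L languages of intermediate growth.
   Context: The growth of a language $L\subseteq\Sigma^*$ (with $\Sigma$ a finite alphabet) is the function $f:\mathbb N\to\mathbb N$ where $f(n)$ is the number of words in $L$ of length $n$. The language $L$ has intermediate growth if for any $\alpha,\beta>1$ there is $N\in\mathbb N$ such that $n^\alpha<f(n)<\beta^n$ for all $n>N$. All alphabets are finite. A table over an alphabet $C$ is a finite subset $h\subseteq C\times C^*$; if $h$ contains no pair with first coordinate $c\in C$, then by convention the pair $(c,c)$ is taken to belong to $h$. For words $u=c_1\cdots c_m$ (with $c_j\in C$) and $v\in C^*$ write $u\longrightarrow^h v$ if $v=v_1\cdots v_m$ with $(c_j,v_j)\in h$ for every $j$. For a word $r=h_1\cdots h_n$ over a set of tables, $u\longrightarrow^r v$ means there are words $u=u_0,u_1,\dots,u_n=v$ with $u_{j-1}\longrightarrow^{h_j}u_j$ for all $j$. A language $L\subseteq A^*$ is ET0L if there are an alphabet $C\supseteq A$, a finite set $H$ of tables over $C$, a regular language $\mathcal R\subseteq H^*$ and a letter $c\in C$ such that $L=\{w\in A^*\mid c\longrightarrow^r w\text{ for some }r\in\mathcal R\}$. It is EDT0L if this can be done with every table $h\in H$ deterministic, i.e. containing exactly one pair for each first coordinate in $C$. *)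

theory Defs
  imports Complex_Main
begin

text \<open>Alphabets are finite sets of letters, words are lists, and \<open>lists A\<close> is the set of all
  words over \<open>A\<close>.\<close>

definition growth :: "'a list set \<Rightarrow> nat \<Rightarrow> nat" where
  "growth L n = card {w \<in> L. length w = n}"

definition intermediate_growth :: "'a list set \<Rightarrow> bool" where
  "intermediate_growth L \<longleftrightarrow>
     (\<forall>\<alpha> \<beta> :: real. \<alpha> > 1 \<longrightarrow> \<beta> > 1 \<longrightarrow>
        (\<exists>N. \<forall>n>N. real n powr \<alpha> < real (growth L n) \<and> real (growth L n) < \<beta> ^ n))"

text \<open>Regularity over the finite alphabet \<open>H\<close>, as acceptance by a complete deterministic finite
  automaton. States are natural numbers, which loses no generality as there are finitely many.\<close>

definition regular_language :: "'b set \<Rightarrow> 'b list set \<Rightarrow> bool" where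
  "regular_language H R \<longleftrightarrow>
     (\<exists>(Q :: nat set) q0 F \<delta>. finite Q \<and> q0 \<in> Q \<and> F \<subseteq> Q \<and> (\<forall>q\<in>Q. \<forall>h\<in>H. \<delta> q h \<in> Q) \<and>
        R = {r \<in> lists H. foldl \<delta> q0 r \<in> F})"

type_synonym 'a table = "('a \<times> 'a list) set"

definition is_table :: "'a set \<Rightarrow> 'a table \<Rightarrow> bool" where
  "is_table C h \<longleftrightarrow> finite h \<and> h \<subseteq> C \<times> lists C"

text \<open>The convention that a letter of \<open>C\<close> without any pair in the table is rewritten to itself.\<close>

definition table_completion :: "'a set \<Rightarrow> 'a table \<Rightarrow> 'a table" where
  "table_completion C h = h \<union> {(c, [c]) | c. c \<in> C \<and> (\<forall>v. (c, v) \<notin> h)}"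

text \<open>Determinism is understood after applying this convention.\<close>

definition deterministic_table :: "'a set \<Rightarrow> 'a table \<Rightarrow> bool" where
  "deterministic_table C h \<longleftrightarrow> (\<forall>c\<in>C. \<exists>!v. (c, v) \<in> table_completion C h)"

definition table_step :: "'a set \<Rightarrow> 'a table \<Rightarrow> 'a list \<Rightarrow> 'a list \<Rightarrow> bool" where
  "table_step C h u v \<longleftrightarrow>
     (\<exists>vs. list_all2 (\<lambda>c w. (c, w) \<in> table_completion C h) u vs \<and> v = concat vs)"

fun table_derives :: "'a set \<Rightarrow> 'a table list \<Rightarrow> 'a list \<Rightarrow> 'a list \<Rightarrow> bool" where
  "table_derives C [] u v \<longleftrightarrow> u = v"
| "table_derives C (h # r) u v \<longleftrightarrow> (\<exists>w. table_step C h u w \<and> table_derives C r w v)"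

definition generates ::
  "'a set \<Rightarrow> 'a set \<Rightarrow> 'a table set \<Rightarrow> 'a table list set \<Rightarrow> 'a \<Rightarrow> 'a list set \<Rightarrow> bool" where
  "generates A C H R c L \<longleftrightarrow>
     finite C \<and> A \<subseteq> C \<and> finite H \<and> (\<forall>h\<in>H. is_table C h) \<and> regular_language H R \<and> c \<in> C \<and>
     L = {w \<in> lists A. \<exists>r\<in>R. table_derives C r [c] w}"

text \<open>The extended alphabet \<open>C\<close> is drawn from the same letter type as \<open>A\<close>, so these two notions
  are the intended ones when that type is infinite.\<close>

definition ET0L :: "'a set \<Rightarrow> 'a list set \<Rightarrow> bool" where
  "ET0L A L \<longleftrightarrow> (\<exists>C H R c. generates A C H R c L)"

definition EDT0L :: "'a set \<Rightarrow> 'a list set \<Rightarrow> bool" where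
  "EDT0L A L \<longleftrightarrow>
     (\<exists>C H R c. generates A C H R c L \<and> (\<forall>h\<in>H. deterministic_table C h))"

end

theory Submission
  imports Defs "HOL-Real_Asymp.Real_Asymp"
begin

text \<open>
  Every EDT0L language is ET0L, so one example serves both halves. The idea is to store a word
  \<open>b\<^sub>1 \<dots> b\<^sub>k\<close> of \<open>k\<close> free bits in a word whose length is quadratic in \<open>k\<close>. The number of
  words of length \<open>n\<close> is then \<open>2\<close> raised to the order of \<open>sqrt n\<close>, strictly between polynomial and exponential growth.

  Concretely, write the bits with the letters \<open>1\<close> and \<open>2\<close>, and encode them as
  \<open>b\<^sub>k b\<^sub>k\<^sub>-\<^sub>1 0 b\<^sub>k\<^sub>-\<^sub>2 00 \<dots> b\<^sub>1 0\<^sup>k\<^sup>-\<^sup>1\<close>. Deterministic tables produce this, because one table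
  application acts on the whole word: the table that inserts a new bit can at the same time append
  a \<open>0\<close> behind every older bit. To reach every length, and not only the triangular numbers
  \<open>k (k + 1) / 2\<close>, a second kind of table puts arbitrarily many zeros in front. Deleting the
  zeros recovers the bits, and the length then determines the padding, so the words of length \<open>n\<close>
  correspond exactly to the bit words with \<open>k (k + 1) / 2 \<le> n\<close> (lemma \<open>growth_padded_rows\<close>).
\<close>

section \<open>Tables given by functions on letters\<close>

definition morphism_table :: "'a set \<Rightarrow> ('a \<Rightarrow> 'a list) \<Rightarrow> 'a table" where
  "morphism_table C f = (\<lambda>c. (c, f c)) ` C"

lemma table_completion_morphism_table [simp]:
  "table_completion C (morphism_table C f) = morphism_table C f"
  by (auto simp: table_completion_def morphism_table_def)

lemma is_table_morphism_table:
  assumes "finite C" and "f ` C \<subseteq> lists C"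
  shows "is_table C (morphism_table C f)"
  using assms by (auto simp: is_table_def morphism_table_def)

lemma deterministic_morphism_table: "deterministic_table C (morphism_table C f)"
  unfolding deterministic_table_def table_completion_morphism_table
  by (auto simp: morphism_table_def)

lemma table_step_morphism_table:
  assumes "u \<in> lists C"
  shows "table_step C (morphism_table C f) u v \<longleftrightarrow> v = concat (map f u)"
proof -
  have "list_all2 (\<lambda>c w. (c, w) \<in> morphism_table C f) u vs \<longleftrightarrow> vs = map f u" for vs
    using assms
    by (induction u arbitrary: vs) (auto simp: morphism_table_def list_all2_Cons1)
  then show ?thesis
    by (simp add: table_step_def)
qed

lemma table_derives_append:
  "table_derives C (r @ r') u w \<longleftrightarrow> (\<exists>v. table_derives C r u v \<and> table_derives C r' v w)"
  by (induction r arbitrary: u) auto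

lemma regular_language_lists: "regular_language H (lists H)"
proof -
  have "foldl (\<lambda>(q::nat) h. q) 0 r = 0" for r :: "'a list"
    by (induction r) auto
  then show ?thesis
    unfolding regular_language_def
    by (intro exI[of _ "{0}"] exI[of _ 0] exI[of _ "\<lambda>q h. q"]) auto
qed

section \<open>An EDT0L system storing bits in triangular words\<close>

abbreviation start :: nat where "start \<equiv> 3"
abbreviation tip :: nat where "tip \<equiv> 4"

text \<open>The letter \<open>tip\<close> marks the end of each block of zeros; it is the place where the block grows.\<close>

definition letters :: "nat set" where "letters = {0, 1, 2, start, tip}"

definition emit :: "nat \<Rightarrow> nat \<Rightarrow> nat list" where
  "emit b c = (if c = start then [start, b, tip] else if c = tip then [0, tip] else [c])"

definition pad :: "nat \<Rightarrow> nat list" where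
  "pad c = (if c = start then [0, start] else [c])"

definition finish :: "nat \<Rightarrow> nat list" where
  "finish c = (if c = start \<or> c = tip then [] else [c])"

definition productions :: "(nat \<Rightarrow> nat list) set" where
  "productions = {emit 1, emit 2, pad, finish}"

definition tables :: "nat table set" where
  "tables = morphism_table letters ` productions"

text \<open>The parameter \<open>e\<close> is the end of each block: \<open>[tip]\<close> while the derivation runs, and empty
  once the word is terminal.\<close>

fun rows :: "nat list \<Rightarrow> nat \<Rightarrow> nat list \<Rightarrow> nat list" where
  "rows e i [] = []"
| "rows e i (b # bs) = b # replicate i 0 @ e @ rows e (Suc i) bs"

definition padded_rows :: "nat list set" where
  "padded_rows = {replicate j 0 @ rows [] 0 bs | j bs. bs \<in> lists {1, 2}}"

definition active_words :: "nat list set" where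
  "active_words = {replicate j 0 @ start # rows [tip] 0 bs | j bs. bs \<in> lists {1, 2}}"

lemma map_replicate_fixed: "f 0 = [0] \<Longrightarrow> concat (map f (replicate j (0::nat))) = replicate j 0"
  by (induction j) auto

lemma emit_rows:
  "bs \<in> lists {1, 2} \<Longrightarrow> concat (map (emit b) (rows [tip] i bs)) = rows [tip] (Suc i) bs"
  by (induction bs arbitrary: i)
     (auto simp: emit_def map_replicate_fixed replicate_append_same simp flip: replicate_Suc)

lemma pad_rows: "bs \<in> lists {1, 2} \<Longrightarrow> concat (map pad (rows [tip] i bs)) = rows [tip] i bs"
  by (induction bs arbitrary: i) (auto simp: pad_def map_replicate_fixed)

lemma finish_rows: "bs \<in> lists {1, 2} \<Longrightarrow> concat (map finish (rows [tip] i bs)) = rows [] i bs"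
  by (induction bs arbitrary: i) (auto simp: finish_def map_replicate_fixed)

lemma set_rows: "bs \<in> lists {1, 2} \<Longrightarrow> set (rows e i bs) \<subseteq> {0, 1, 2} \<union> set e"
  by (induction bs arbitrary: i) auto

lemma emit_active:
  assumes "bs \<in> lists {1, 2}"
  shows "concat (map (emit b) (replicate j 0 @ start # rows [tip] 0 bs)) =
    replicate j 0 @ start # rows [tip] 0 (b # bs)"
  using assms by (simp add: emit_rows map_replicate_fixed emit_def[of _ 0] emit_def[of _ start])

lemma pad_active:
  assumes "bs \<in> lists {1, 2}"
  shows "concat (map pad (replicate j 0 @ start # rows [tip] 0 bs)) =
    replicate (Suc j) 0 @ start # rows [tip] 0 bs"
  using assms
  by (simp add: pad_rows map_replicate_fixed pad_def[of 0] pad_def[of start] replicate_app_Cons_same)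

lemma finish_active:
  assumes "bs \<in> lists {1, 2}"
  shows "concat (map finish (replicate j 0 @ start # rows [tip] 0 bs)) =
    replicate j 0 @ rows [] 0 bs"
  using assms by (simp add: finish_rows map_replicate_fixed finish_def[of 0] finish_def[of start])

lemma active_words_subset: "active_words \<subseteq> lists letters"
  using set_rows[of _ "[tip]" 0] by (fastforce simp: active_words_def letters_def)

lemma padded_rows_subset: "padded_rows \<subseteq> lists {0, 1, 2}"
  using set_rows[of _ "[]" 0] by (fastforce simp: padded_rows_def)

lemma morphism_active_words:
  assumes "f \<in> productions" and "u \<in> active_words"
  shows "concat (map f u) \<in> active_words \<union> padded_rows"
proof -
  from assms(2) obtain j bs where bs: "bs \<in> lists {1, 2}"
    and u: "u = replicate j 0 @ start # rows [tip] 0 bs"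
    unfolding active_words_def by blast
  have "concat (map (emit b) u) \<in> active_words" if "b \<in> {1, 2}" for b
    using bs that unfolding u emit_active[OF bs] active_words_def
    by (intro CollectI exI[of _ j] exI[of _ "b # bs"]) auto
  moreover have "concat (map pad u) \<in> active_words"
    using bs unfolding u pad_active[OF bs] active_words_def by blast
  moreover have "concat (map finish u) \<in> padded_rows"
    using bs unfolding u finish_active[OF bs] padded_rows_def by blast
  ultimately show ?thesis
    using assms(1) by (auto simp: productions_def)
qed

text \<open>No letter of a finished word is ever rewritten again, so the language stays the same when tables
  are applied after \<open>finish\<close>. This is why the control language can be all sequences of tables.\<close>

lemma morphism_padded_rows:
  assumes "f \<in> productions" and "u \<in> padded_rows"
  shows "concat (map f u) = u"
proof -
  have "u \<in> lists {0, 1, 2}"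
    using assms(2) padded_rows_subset by blast
  moreover have "f c = [c]" if "c \<in> {0, 1, 2}" for c
    using assms(1) that by (auto simp: productions_def emit_def pad_def finish_def)
  ultimately show ?thesis
    by (induction u) auto
qed

text \<open>The invariant of all derivations: a word reached from \<open>start\<close> is a padding followed by
  triangular bit blocks, and \<open>finish\<close> removes the nonterminal letters \<open>start\<close> and \<open>tip\<close> simultaneously. So no
  half-finished word can occur, in which some blocks still grow and others do not.\<close>

lemma table_derives_tables_closed:
  assumes "r \<in> lists tables" and "table_derives letters r u v"
    and "u \<in> active_words \<union> padded_rows"
  shows "v \<in> active_words \<union> padded_rows"
  using assms
proof (induction r arbitrary: u rule: lists.induct)
  case (Cons h r)
  from Cons.hyps(1) obtain f where f: "f \<in> productions" and h: "h = morphism_table letters f"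
    by (auto simp: tables_def)
  from Cons.prems(1) obtain w where w: "table_step letters h u w"
    and r: "table_derives letters r w v"
    by auto
  have "u \<in> lists letters"
    using Cons.prems(2) active_words_subset padded_rows_subset by (auto simp: letters_def)
  then have "w = concat (map f u)"
    using w h by (simp add: table_step_morphism_table)
  then have "w \<in> active_words \<union> padded_rows"
    using Cons.prems(2) f morphism_active_words morphism_padded_rows by (metis Un_iff)
  then show ?case
    using Cons.IH r by blast
qed auto

lemma table_derives_snoc_morphism:
  assumes "table_derives letters r u v" and "r \<in> lists tables" and "v \<in> active_words"
    and "f \<in> productions"
  shows "\<exists>r\<in>lists tables. table_derives letters r u (concat (map f v))"
proof
  have "v \<in> lists letters"
    using assms(3) active_words_subset by blast
  then have "table_derives letters [morphism_table letters f] v (concat (map f v))"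
    by (simp add: table_step_morphism_table)
  then show "table_derives letters (r @ [morphism_table letters f]) u (concat (map f v))"
    using assms(1) unfolding table_derives_append by blast
  show "r @ [morphism_table letters f] \<in> lists tables"
    using assms(2,4) by (simp add: tables_def)
qed

text \<open>The padding zeros appear to the left of \<open>start\<close> and the bits to its right, so the two kinds of
  steps commute; it suffices to derive all of the padding before the bits.\<close>

lemma active_words_derivable:
  assumes "bs \<in> lists {1, 2}"
  shows "\<exists>r\<in>lists tables.
    table_derives letters r [start] (replicate j 0 @ start # rows [tip] 0 bs)"
  using assms
proof (induction bs rule: lists.induct)
  case Nil
  show ?case
  proof (induction j)
    case 0
    show ?case by (intro bexI[of _ "[]"]) auto
  next
    case (Suc j)
    moreover have "replicate j 0 @ start # rows [tip] 0 [] \<in> active_words"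
      unfolding active_words_def by blast
    moreover have "pad \<in> productions" by (simp add: productions_def)
    ultimately show ?case
      using table_derives_snoc_morphism pad_active[of "[]" j] by (metis lists.Nil)
  qed
next
  case (Cons b bs)
  then have "replicate j 0 @ start # rows [tip] 0 bs \<in> active_words"
    unfolding active_words_def by blast
  moreover have "emit b \<in> productions"
    using Cons.hyps by (auto simp: productions_def)
  ultimately show ?case
    using table_derives_snoc_morphism Cons emit_active[of bs b j] by metis
qed

lemma padded_rows_eq_generated:
  "padded_rows =
    {w \<in> lists {0, 1, 2}. \<exists>r\<in>lists tables. table_derives letters r [start] w}" (is "_ = ?L")
proof
  show "padded_rows \<subseteq> ?L"
  proof
    fix w assume w: "w \<in> padded_rows"
    then obtain j bs where bs: "bs \<in> lists {1, 2}" and w_eq: "w = replicate j 0 @ rows [] 0 bs"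
      unfolding padded_rows_def by blast
    have "replicate j 0 @ start # rows [tip] 0 bs \<in> active_words"
      using bs unfolding active_words_def by blast
    moreover have "finish \<in> productions" by (simp add: productions_def)
    ultimately have "\<exists>r\<in>lists tables. table_derives letters r [start] w"
      using table_derives_snoc_morphism active_words_derivable[OF bs] finish_active[OF bs]
      unfolding w_eq by metis
    then show "w \<in> ?L"
      using w padded_rows_subset by blast
  qed
  show "?L \<subseteq> padded_rows"
  proof
    fix w assume "w \<in> ?L"
    then obtain r where w: "w \<in> lists {0, 1, 2}" and r: "r \<in> lists tables"
      and d: "table_derives letters r [start] w"
      by blast
    have "[start] = replicate 0 0 @ start # rows [tip] 0 []" by simp
    then have "[start] \<in> active_words"
      unfolding active_words_def by blast
    then have "w \<in> active_words \<union> padded_rows"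
      using table_derives_tables_closed[OF r d] by blast
    moreover have "w \<notin> active_words"
      using w by (auto simp: active_words_def)
    ultimately show "w \<in> padded_rows" by blast
  qed
qed

lemma generates_padded_rows:
  "generates {0, 1, 2} letters tables (lists tables) start padded_rows"
proof -
  have "is_table letters h" if "h \<in> tables" for h
    using that
    by (auto simp: tables_def productions_def letters_def emit_def pad_def finish_def
        intro!: is_table_morphism_table)
  then show ?thesis
    using padded_rows_eq_generated
    by (auto simp: generates_def regular_language_lists letters_def tables_def productions_def)
qed

lemma EDT0L_imp_ET0L: "EDT0L A L \<Longrightarrow> ET0L A L"
  unfolding EDT0L_def ET0L_def by blast

section \<open>Growth\<close>

lemma length_rows: "2 * length (rows [] i bs) = length bs * (length bs + 2 * i + 1)"
proof (induction bs arbitrary: i)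
  case (Cons b bs)
  then show ?case
    using Cons.IH[of "Suc i"] by (simp add: algebra_simps)
qed simp

lemma filter_rows: "bs \<in> lists {1, 2} \<Longrightarrow> filter (\<lambda>c. c \<noteq> 0) (rows [] i bs) = bs"
  by (induction bs arbitrary: i) auto

text \<open>The encoding of the bits is undone by deleting zeros. The inequality says that the
  blocks of the given bits, of total length \<open>k (k + 1) / 2\<close>, fit into \<open>n\<close> letters; the rest is
  filled with padding in exactly one way.\<close>

lemma growth_padded_rows:
  "growth padded_rows n = card {bs \<in> lists {1, 2 :: nat}. length bs * (length bs + 1) \<le> 2 * n}"
proof -
  define B where "B = {bs \<in> lists {1, 2 :: nat}. length bs * (length bs + 1) \<le> 2 * n}"
  define enc where "enc bs = replicate (n - length (rows [] 0 bs)) 0 @ rows [] 0 bs" for bs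
  have len: "2 * length (rows [] 0 bs) = length bs * (length bs + 1)" for bs
    using length_rows[of 0 bs] by simp
  have "filter (\<lambda>c. c \<noteq> 0) (enc bs) = bs" if "bs \<in> B" for bs
    using that filter_rows by (auto simp: B_def enc_def)
  then have inj: "inj_on enc B"
    by (rule inj_on_inverseI)
  have "{w \<in> padded_rows. length w = n} = enc ` B"
  proof (intro subset_antisym subsetI)
    fix w assume "w \<in> {w \<in> padded_rows. length w = n}"
    then obtain j bs where bs: "bs \<in> lists {1, 2}"
      and w: "w = replicate j 0 @ rows [] 0 bs" "length w = n"
      unfolding padded_rows_def by blast
    then have n: "n = j + length (rows [] 0 bs)" by simp
    then have "bs \<in> B"
      using bs len[of bs] by (simp add: B_def)
    moreover have "w = enc bs"
      using w n by (simp add: enc_def)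
    ultimately show "w \<in> enc ` B" by blast
  next
    fix w assume "w \<in> enc ` B"
    then obtain bs where bs: "bs \<in> lists {1, 2}" "length bs * (length bs + 1) \<le> 2 * n"
      and w: "w = enc bs"
      unfolding B_def by blast
    have "length (rows [] 0 bs) \<le> n"
      using bs(2) len[of bs] by simp
    then have "length w = n"
      by (simp add: w enc_def)
    moreover have "w \<in> padded_rows"
      using bs(1) unfolding w enc_def padded_rows_def by blast
    ultimately show "w \<in> {w \<in> padded_rows. length w = n}" by simp
  qed
  then show ?thesis
    using card_image[OF inj] by (simp add: growth_def B_def)
qed

lemma card_bit_words: "card {bs \<in> lists {1, 2 :: nat}. length bs = k} = 2 ^ k"
proof -
  have "{bs \<in> lists {1, 2 :: nat}. length bs = k} = {bs. set bs \<subseteq> {1, 2} \<and> length bs = k}"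
    by auto
  then show ?thesis
    using card_lists_length_eq[of "{1, 2 :: nat}" k] by (simp add: numeral_2_eq_2)
qed

lemma finite_bit_words_le: "finite {bs \<in> lists {1, 2 :: nat}. length bs \<le> K}"
  by (rule finite_subset[OF _ finite_lists_length_le[of "{1, 2}" K]]) auto

lemma card_bit_words_le: "card {bs \<in> lists {1, 2 :: nat}. length bs \<le> K} \<le> 2 ^ Suc K"
proof -
  have "{bs \<in> lists {1, 2 :: nat}. length bs \<le> K} =
      (\<Union>k\<in>{..K}. {bs \<in> lists {1, 2}. length bs = k})"
    by auto
  then have "card {bs \<in> lists {1, 2 :: nat}. length bs \<le> K} \<le> (\<Sum>k\<le>K. 2 ^ k)"
    using card_UN_le[of "{..K}" "\<lambda>k. {bs \<in> lists {1, 2 :: nat}. length bs = k}"]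
    by (simp only: card_bit_words finite_atMost)
  also have "\<dots> \<le> 2 ^ Suc K"
    by (induction K) simp_all
  finally show ?thesis .
qed

text \<open>If \<open>k\<close> bits fit, then \<open>k\<^sup>2 \<le> 2 n\<close>, and there are fewer than \<open>2 ^ (K + 1)\<close> bit words of
  length at most \<open>K\<close>.\<close>

lemma growth_padded_rows_le: "real (growth padded_rows n) \<le> 2 * 2 powr sqrt (2 * n)"
proof -
  define K where "K = nat \<lfloor>sqrt (2 * n)\<rfloor>"
  have "length bs \<le> K" if "length bs * (length bs + 1) \<le> 2 * n" for bs :: "nat list"
  proof -
    have "(length bs)\<^sup>2 \<le> 2 * n"
      using that by (simp add: power2_eq_square)
    then have "(real (length bs))\<^sup>2 \<le> 2 * real n"
      by (metis of_nat_le_iff of_nat_power of_nat_mult of_nat_numeral)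
    then have "real (length bs) \<le> sqrt (2 * n)"
      by (simp add: real_le_rsqrt)
    then show ?thesis
      by (simp add: K_def le_nat_iff le_floor_iff)
  qed
  then have "growth padded_rows n \<le> card {bs \<in> lists {1, 2 :: nat}. length bs \<le> K}"
    unfolding growth_padded_rows by (intro card_mono finite_bit_words_le) auto
  also note card_bit_words_le
  finally have "real (growth padded_rows n) \<le> 2 * 2 powr real K"
    by (simp add: powr_realpow flip: of_nat_le_iff[where ?'a = real])
  also have "\<dots> \<le> 2 * 2 powr sqrt (2 * n)"
    by (simp add: K_def)
  finally show ?thesis .
qed

text \<open>Bit words of the single length \<open>k = \<lfloor>sqrt n\<rfloor>\<close> suffice: they fit because \<open>k \<le> k\<^sup>2 \<le> n\<close>.\<close>

lemma growth_padded_rows_ge: "2 powr (sqrt n - 1) \<le> real (growth padded_rows n)"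
proof -
  define k where "k = nat \<lfloor>sqrt n\<rfloor>"
  have "real k \<le> sqrt n"
    by (simp add: k_def)
  then have "(real k)\<^sup>2 \<le> real n"
    by (metis of_nat_0_le_iff real_sqrt_le_iff real_sqrt_unique sqrt_le_D)
  then have "k\<^sup>2 \<le> n"
    by (metis of_nat_le_iff of_nat_power)
  then have k: "k * (k + 1) \<le> 2 * n"
    using le_square[of k] unfolding power2_eq_square distrib_left by linarith
  have "finite {bs \<in> lists {1, 2 :: nat}. length bs * (length bs + 1) \<le> 2 * n}"
  proof (rule finite_subset[OF _ finite_bit_words_le[of "2 * n"]], intro subsetI CollectI conjI)
    fix bs assume bs: "bs \<in> {bs \<in> lists {1, 2 :: nat}. length bs * (length bs + 1) \<le> 2 * n}"
    then show "bs \<in> lists {1, 2}" by simp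
    have "length bs \<le> length bs * (length bs + 1)" by simp
    also have "\<dots> \<le> 2 * n" using bs by simp
    finally show "length bs \<le> 2 * n" .
  qed
  then have "card {bs \<in> lists {1, 2 :: nat}. length bs = k} \<le> growth padded_rows n"
    unfolding growth_padded_rows using k by (intro card_mono) auto
  then have "2 ^ k \<le> growth padded_rows n"
    by (simp only: card_bit_words)
  then have "real (2 ^ k) \<le> real (growth padded_rows n)"
    by (simp only: of_nat_le_iff)
  then have "2 powr real k \<le> real (growth padded_rows n)"
    by (simp add: powr_realpow)
  moreover have "sqrt n - 1 \<le> real k"
    unfolding k_def by linarith
  ultimately show ?thesis
    by (meson order_trans powr_mono one_le_numeral)
qed

lemma intermediate_growth_padded_rows: "intermediate_growth padded_rows"
  unfolding intermediate_growth_def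
proof (intro allI impI)
  fix \<alpha> \<beta> :: real
  assume "\<alpha> > 1" and \<beta>: "\<beta> > 1"
  have "\<forall>\<^sub>F n :: nat in sequentially. real n powr \<alpha> < 2 powr (sqrt n - 1)"
    using \<open>\<alpha> > 1\<close> by real_asymp
  moreover have "\<forall>\<^sub>F n :: nat in sequentially. 2 * 2 powr sqrt (2 * n) < \<beta> powr n"
    using \<beta> by real_asymp
  ultimately have "\<forall>\<^sub>F n in sequentially.
      real n powr \<alpha> < real (growth padded_rows n) \<and> real (growth padded_rows n) < \<beta> ^ n"
  proof eventually_elim
    case (elim n)
    then show ?case
      using growth_padded_rows_le[of n] growth_padded_rows_ge[of n] \<beta> by (simp add: powr_realpow)
  qed
  then show "\<exists>N. \<forall>n>N. real n powr \<alpha> < real (growth padded_rows n) \<and>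
      real (growth padded_rows n) < \<beta> ^ n"
    unfolding eventually_sequentially by (meson less_imp_le)
qed

theorem corollary8:
  shows "(\<exists>(A :: nat set) L. finite A \<and> EDT0L A L \<and> intermediate_growth L) \<and>
         (\<exists>(A :: nat set) L. finite A \<and> ET0L A L \<and> intermediate_growth L)"
proof -
  have "\<forall>h\<in>tables. deterministic_table letters h"
    by (auto simp: tables_def deterministic_morphism_table)
  then have "EDT0L {0, 1, 2} padded_rows"
    unfolding EDT0L_def using generates_padded_rows by blast
  moreover have "finite {0, 1, 2 :: nat}" by simp
  ultimately show ?thesis
    using EDT0L_imp_ET0L intermediate_growth_padded_rows by blast
qed

end
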